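(* Let $d,k,n\in\mathbb{N}$ with $2k\le n$, and set $a_d=(8d)^{5d}$ and $c_d=6d\,8^{-d}$. Then $$\delta(n,k,d)\le a_d\,k^{-c_d}.$$
   Context: A pattern of order $t$ is an element $P\in\{+,-\}^t$. A pattern is $d$-balanced if exactly $d$ of its entries are $+$ and exactly $d$ are $-$ (so it has order $2d$). For $A,B\subset[n]=\{1,\dots,n\}$ write $\mathrm{pat}(A,B)=P$ if $A\triangle B=\{j_1,\dots,j_t\}$ with $j_1<\dots<j_t$, $P$ has order $t$, and $\{i\in[t]:P_i=+\}=\{i\in[t]: j_i\in A\setminus B\}$. A family $\mathcal{A}$ of subsets of $[n]$ is $P$-free if $\mathrm{pat}(A,B)\neq P$ for all $A,B\in\mathcal{A}$. For $0\le k\le n$, $f(n,k,P)$ is the maximum size of a $P$-free family $\mathcal{A}\subset\binom{[n]}{k}$ (the $k$-element subsets of $[n]$), and $\delta(n,k,P)=f(n,k,P)/\binom{n}{k}$. Finally $\delta(n,k,d)=\max\{\delta(n,k,P): P \text{ is } d\text{-balanced}\}$. *)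

theory Defs
  imports Complex_Main
begin

datatype psign = SPlus | SMinus

type_synonym pattern = "psign list"

definition balanced :: "nat \<Rightarrow> pattern \<Rightarrow> bool" where
  "balanced d P \<longleftrightarrow> count_list P SPlus = d \<and> count_list P SMinus = d"

text \<open>Meaningful only when the symmetric difference is finite, which is always the case for
  subsets of \<open>{1..n}\<close>. If \<open>A = B\<close>, the result is the empty pattern.\<close>

definition pat :: "nat set \<Rightarrow> nat set \<Rightarrow> pattern" where
  "pat A B = map (\<lambda>j. if j \<in> A - B then SPlus else SMinus) (sorted_list_of_set (sym_diff A B))"

definition pattern_free :: "pattern \<Rightarrow> nat set set \<Rightarrow> bool" where
  "pattern_free P \<A> \<longleftrightarrow> (\<forall>A\<in>\<A>. \<forall>B\<in>\<A>. pat A B \<noteq> P)"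

definition layer :: "nat \<Rightarrow> nat \<Rightarrow> nat set set" where
  "layer n k = {A. A \<subseteq> {1..n} \<and> card A = k}"

definition max_free :: "nat \<Rightarrow> nat \<Rightarrow> pattern \<Rightarrow> nat" where
  "max_free n k P = Max (card ` {\<A>. \<A> \<subseteq> layer n k \<and> pattern_free P \<A>})"

definition density :: "nat \<Rightarrow> nat \<Rightarrow> pattern \<Rightarrow> real" where
  "density n k P = real (max_free n k P) / real (n choose k)"

definition max_density :: "nat \<Rightarrow> nat \<Rightarrow> nat \<Rightarrow> real" where
  "max_density n k d = Max (density n k ` {P. balanced d P})"

text \<open>Both maxima range over finite nonempty sets.\<close>

lemma finite_layer: "finite (layer n k)"
  by (rule finite_subset[of _ "Pow {1..n}"]) (auto simp: layer_def)

lemma finite_free_families: "finite {\<A>. \<A> \<subseteq> layer n k \<and> pattern_free P \<A>}"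
  by (rule finite_subset[of _ "Pow (layer n k)"]) (auto simp: finite_layer)

lemma free_families_nonempty: "{\<A>. \<A> \<subseteq> layer n k \<and> pattern_free P \<A>} \<noteq> {}"
  by (auto simp: pattern_free_def intro!: exI[of _ "{}"])

lemma length_pattern: "length P = count_list P SPlus + count_list P SMinus"
proof (induction P)
  case (Cons a P)
  then show ?case by (cases a) auto
qed simp

lemma finite_balanced: "finite {P. balanced d P}"
proof (rule finite_subset)
  show "{P. balanced d P} \<subseteq> {P. set P \<subseteq> {SPlus, SMinus} \<and> length P = 2 * d}"
    by (auto simp: balanced_def length_pattern intro: psign.exhaust)
  show "finite {P. set P \<subseteq> {SPlus, SMinus} \<and> length P = 2 * d}"
    by (rule finite_lists_length_eq) simp
qed

lemma balanced_nonempty: "{P. balanced d P} \<noteq> {}"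
proof -
  have "count_list (replicate m x) y = (if x = y then m else 0)" for m and x y :: psign
    by (induction m) auto
  then have "balanced d (replicate d SPlus @ replicate d SMinus)"
    by (simp add: balanced_def)
  then show ?thesis by blast
qed

end

theory Submission
  imports Defs
begin

text \<open>
  Averaging over \<open>k\<close>-sets \<open>U \<subseteq> {1..n}\<close> bounds the density of a \<open>P\<close>-free family in the \<open>k\<close>-th layer by
  the density of a \<open>P\<close>-free family in a cube \<open>Pow U\<close>; in cubes, restricting to subcubes needs no tail
  estimates. There one inducts on \<open>d\<close>. By the intermediate value theorem for the partial sums, a
  balanced pattern is either \<open>s Q s'\<close> with \<open>s \<noteq> s'\<close> and \<open>Q\<close> balanced, or a concatenation \<open>P1 P2\<close> of
  nonempty balanced patterns. In the first case, divide the \<open>m\<close> points into residue classes modulo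
  \<open>w\<close>. Many pairs \<open>(S, t)\<close>, \<open>(S, t')\<close> with \<open>t, t'\<close> in one class satisfy \<open>S \<union> {t}, S \<union> {t'} \<in> \<A>\<close>, so some
  pair \<open>t < t'\<close> works for a positive proportion of the sets \<open>S\<close>. These \<open>S\<close> are \<open>Q\<close>-free inside the
  at least \<open>w - 1\<close> points between \<open>t\<close> and \<open>t'\<close>, whence \<open>\<delta> \<le> 2 w / m + (2 m / w) \<beta>\<close>. In the second case,
  cut off \<open>l\<close> points for the shorter pattern, say \<open>P1\<close>. A dense fibre contains many \<open>P1\<close>-pairs, and the
  common link of a \<open>P1\<close>-pair is \<open>P2\<close>-free, whence \<open>\<delta> \<le> \<alpha> + l ^ (2 d1) \<beta>\<close>.\<close>

section \<open>Patterns of pairs of sets and the decomposition of balanced patterns\<close>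

fun flip :: "psign \<Rightarrow> psign" where
  "flip SPlus = SMinus"
| "flip SMinus = SPlus"

lemma psign_neq_iff: "s \<noteq> s' \<longleftrightarrow> s' = flip s"
  by (cases s; cases s') auto

lemma length_pat: "length (pat A B) = card (sym_diff A B)"
  by (simp add: pat_def)

lemma pat_self [simp]: "pat A A = []"
  by (simp add: pat_def)

lemma pat_singleton [simp]: "pat {t} {} = [SPlus]" "pat {} {t} = [SMinus]"
  by (simp_all add: pat_def)

lemma pat_Un_common:
  assumes "C \<inter> (A \<union> B) = {}"
  shows "pat (A \<union> C) (B \<union> C) = pat A B"
proof -
  have 1: "sym_diff (A \<union> C) (B \<union> C) = sym_diff A B" and 2: "(A \<union> C) - (B \<union> C) = A - B" using assms by auto
  show ?thesis unfolding pat_def 1 unfolding 2 ..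
qed

text \<open>Complementing exchanges the two members of a pair. Since freeness quantifies over all
  ordered pairs, the complements of a free family form a free family.\<close>

lemma pat_compl:
  assumes "finite V" "A \<subseteq> V" "B \<subseteq> V"
  shows "pat (V - A) (V - B) = pat B A"
proof -
  have "sym_diff (V - A) (V - B) = sym_diff B A" "(V - A) - (V - B) = B - A" using assms by auto
  then show ?thesis by (simp add: pat_def)
qed

lemma sorted_list_of_set_Un_less:
  fixes X Y :: "'a::linorder set"
  assumes "finite X" "finite Y" "\<And>x y. x \<in> X \<Longrightarrow> y \<in> Y \<Longrightarrow> x < y"
  shows "sorted_list_of_set (X \<union> Y) = sorted_list_of_set X @ sorted_list_of_set Y"
  using assms
  by (intro sorted_distinct_set_unique)
     (auto simp: sorted_append intro: less_imp_le)

lemma pat_append: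
  assumes "finite X" "finite Y" "\<And>x y. x \<in> X \<Longrightarrow> y \<in> Y \<Longrightarrow> x < y"
    and "A \<subseteq> X" "B \<subseteq> X" "C \<subseteq> Y" "D \<subseteq> Y"
  shows "pat (A \<union> C) (B \<union> D) = pat A B @ pat C D"
proof -
  have disj: "X \<inter> Y = {}" using assms(3) by blast
  have eq: "sym_diff (A \<union> C) (B \<union> D) = sym_diff A B \<union> sym_diff C D" using assms disj by blast
  have fin: "finite (sym_diff A B)" "finite (sym_diff C D)"
    using assms by (auto intro: finite_subset)
  have "sorted_list_of_set (sym_diff A B \<union> sym_diff C D)
      = sorted_list_of_set (sym_diff A B) @ sorted_list_of_set (sym_diff C D)"
    using fin assms by (intro sorted_list_of_set_Un_less) blast+
  moreover have "j \<in> (A \<union> C) - (B \<union> D) \<longleftrightarrow> j \<in> A - B" if "j \<in> sym_diff A B" for j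
    using that assms disj by blast
  moreover have "j \<in> (A \<union> C) - (B \<union> D) \<longleftrightarrow> j \<in> C - D" if "j \<in> sym_diff C D" for j
    using that assms disj by blast
  ultimately show ?thesis
    unfolding pat_def eq using fin by (auto simp del: Un_iff Diff_iff)
qed

text \<open>The plus entries count \<open>A - B\<close> and the minus entries count
  \<open>B - A\<close>. This is what lets each layer of a cube be shifted separately when cubes are
  compared with the \<open>k\<close>-th layer.\<close>

lemma pat_balanced_card:
  assumes "finite A" "finite B" "balanced d (pat A B)"
  shows "card A = card B"
proof -
  have *: "count_list (map g (sorted_list_of_set X)) s = card {x \<in> X. g x = s}" if "finite X"
    for X :: "nat set" and g and s :: psign
  proof -
    have "count_list (map g (sorted_list_of_set X)) s = length (filter (\<lambda>x. g x = s) (sorted_list_of_set X))"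
      by (simp add: count_list_eq_length_filter filter_map o_def eq_commute)
    also have "\<dots> = card (set (filter (\<lambda>x. g x = s) (sorted_list_of_set X)))"
      by (rule distinct_card[symmetric]) auto
    finally show ?thesis using that by auto
  qed
  have fin: "finite (sym_diff A B)" using assms by auto
  have "card {x \<in> sym_diff A B. (if x \<in> A - B then SPlus else SMinus) = SPlus}
      = card {x \<in> sym_diff A B. (if x \<in> A - B then SPlus else SMinus) = SMinus}"
    using assms(3) unfolding balanced_def pat_def *[OF fin] by simp
  moreover have "{x \<in> sym_diff A B. (if x \<in> A - B then SPlus else SMinus) = SPlus} = A - B" by auto
  moreover have "{x \<in> sym_diff A B. (if x \<in> A - B then SPlus else SMinus) = SMinus} = B - A" by auto
  ultimately have "card (A - B) = card (B - A)" by simp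
  moreover have "card A = card (A - B) + card (A \<inter> B)"
    using assms card_Diff_subset_Int[of A B] card_mono[of A "A \<inter> B"] by simp
  moreover have "card B = card (B - A) + card (A \<inter> B)"
    using assms card_Diff_subset_Int[of B A] card_mono[of B "A \<inter> B"] by (simp add: Int_commute)
  ultimately show ?thesis by simp
qed

lemma balanced_split_or_enclose:
  assumes "balanced d P" "d \<ge> 1"
  obtains s Q where "P = s # Q @ [flip s]" "balanced (d - 1) Q"
  | P1 P2 d1 d2 where "P = P1 @ P2" "balanced d1 P1" "balanced d2 P2" "d1 \<ge> 1" "d2 \<ge> 1" "d = d1 + d2"
proof -
  define h where "h i = int (count_list (take i P) SPlus) - int (count_list (take i P) SMinus)" for i
  have len: "length P = 2 * d" using assms length_pattern[of P] by (simp add: balanced_def)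
  then obtain s P' where P': "P = s # P'" using assms by (cases P) auto
  then obtain Q s' where Q: "P' = Q @ [s']" using len assms by (cases P' rule: rev_cases) auto
  have lenQ: "length Q = 2 * d - 2" using len P' Q by simp
  show thesis
  proof (cases "s = s'")
    case False
    then have "s' = flip s" by (simp add: psign_neq_iff)
    moreover from this have "balanced (d - 1) Q"
      using assms P' Q by (cases s) (auto simp: balanced_def)
    ultimately show thesis using that(1) P' Q by blast
  next
    case True
    have step: "\<bar>h (Suc i) - h i\<bar> \<le> 1" for i
    proof (cases "i < length P")
      case True
      then show ?thesis by (cases "P ! i") (auto simp: h_def take_Suc_conv_app_nth)
    qed (simp add: h_def)
    \<comment> \<open>The sign \<open>sg\<close> orients the partial sums: \<open>- sg * h i\<close>
      goes from -1 at \<open>i = 1\<close> to 1 at \<open>i = 2 * d - 1\<close> in steps of size at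
      most 1, so it vanishes in between, and both pieces of the cut are nonempty.\<close>
    define sg :: int where "sg = (if s = SPlus then 1 else -1)"
    have h1: "h 1 = sg" by (cases s) (simp_all add: h_def P' sg_def)
    have h2: "h (2 * d - 1) = - sg"
    proof -
      have "take (2 * d - 1) P = s # Q" using lenQ assms(2) by (simp add: P' Q take_Cons' Suc_diff_le)
      then show ?thesis using assms(1) True by (cases s) (auto simp: h_def P' Q sg_def balanced_def)
    qed
    obtain i where i: "1 \<le> i" "i \<le> 2 * d - 1" "sg * h i = 0"
    proof -
      have "\<exists>i. 1 \<le> i \<and> i \<le> 2 * d - 1 \<and> - sg * h i = 0"
      proof (rule nat_intermed_int_val)
        show "\<forall>i. 1 \<le> i \<and> i < 2 * d - 1 \<longrightarrow> \<bar>- sg * h (Suc i) - - sg * h i\<bar> \<le> 1"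
          using step by (auto simp: sg_def abs_minus_commute)
      qed (use assms h1 h2 in \<open>auto simp: sg_def\<close>)
      then show ?thesis using that by auto
    qed
    have hi: "h i = 0" using i(3) by (auto simp: sg_def split: if_splits)
    define d1 where "d1 = count_list (take i P) SPlus"
    have b1: "balanced d1 (take i P)" using hi by (simp add: balanced_def d1_def h_def)
    have l1: "2 * d1 = i" using b1 length_pattern[of "take i P"] i len by (simp add: balanced_def)
    have "count_list P t = count_list (take i P) t + count_list (drop i P) t" for t
      by (metis append_take_drop_id count_list_append)
    then have b2: "balanced (d - d1) (drop i P)"
      using assms(1) b1 by (simp add: balanced_def) (metis add_diff_cancel_left')
    show thesis
      by (rule that(2)[of "take i P" "drop i P" d1 "d - d1"]) (use b1 b2 l1 i in auto)
  qed
qed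

section \<open>Families in cubes: fibres and density bounds\<close>

lemma card_eq_sum_fibres:
  assumes "finite X" "finite Y" "X \<inter> Y = {}" "\<A> \<subseteq> Pow (X \<union> Y)"
  shows "card \<A> = (\<Sum>R\<in>Pow Y. card {S \<in> Pow X. S \<union> R \<in> \<A>})"
proof -
  have "card \<A> = card (SIGMA R:Pow Y. {S \<in> Pow X. S \<union> R \<in> \<A>})"
  proof (rule bij_betw_same_card[symmetric])
    have "A \<inter> X \<union> A \<inter> Y = A" if "A \<in> \<A>" for A
      using that assms(4) by blast
    moreover have "(S \<union> R) \<inter> Y = R \<and> (S \<union> R) \<inter> X = S" if "R \<subseteq> Y" "S \<subseteq> X" for R S
      using that assms(3) by blast
    ultimately show "bij_betw (\<lambda>(R, S). S \<union> R) (SIGMA R:Pow Y. {S \<in> Pow X. S \<union> R \<in> \<A>}) \<A>"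
      by (intro bij_betw_byWitness[where f' = "\<lambda>A. (A \<inter> Y, A \<inter> X)"]) auto
  qed
  also have "\<dots> = (\<Sum>R\<in>Pow Y. card {S \<in> Pow X. S \<union> R \<in> \<A>})"
    using assms by (intro card_SigmaI) auto
  finally show ?thesis .
qed

text \<open>The set \<open>V\<close> is arbitrary, so that a bound applies to subcubes without
  relabelling. Asking for at least \<open>m\<close> points, not exactly \<open>m\<close>, serves
  intervals whose size is known only from below.\<close>

definition cube_bound :: "pattern \<Rightarrow> nat \<Rightarrow> real \<Rightarrow> bool" where
  "cube_bound P m \<beta> \<longleftrightarrow> (\<forall>V \<A>. finite V \<longrightarrow> card V \<ge> m \<longrightarrow> \<A> \<subseteq> Pow V \<longrightarrow> pattern_free P \<A> \<longrightarrow>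
     real (card \<A>) \<le> \<beta> * 2 ^ card V)"

lemma cube_boundD:
  assumes "cube_bound P m \<beta>" "finite V" "card V \<ge> m" "\<A> \<subseteq> Pow V" "pattern_free P \<A>"
  shows "real (card \<A>) \<le> \<beta> * 2 ^ card V"
  using assms unfolding cube_bound_def by blast

text \<open>Every pair \<open>(A, A)\<close> has the empty pattern. This starts the induction, with
  an empty enclosed pattern.\<close>

lemma cube_bound_Nil: "cube_bound [] m 0"
  unfolding cube_bound_def
proof (intro allI impI)
  fix V :: "nat set" and \<A>
  assume "pattern_free [] \<A>"
  then have "\<A> = {}" unfolding pattern_free_def using pat_self by blast
  then show "real (card \<A>) \<le> 0 * 2 ^ card V" by simp
qed

lemma cube_bound_nonneg:
  assumes "cube_bound P m \<beta>"
  shows "\<beta> \<ge> 0"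
proof -
  have "0 \<le> \<beta> * 2 ^ card {..<m}"
    using cube_boundD[OF assms, of "{..<m}" "{}"] by (simp add: pattern_free_def)
  then show ?thesis using zero_le_mult_iff[of \<beta> "2 ^ card {..<m}"] zero_less_power[of "2::real" "card {..<m}"]
    by linarith
qed

subsection \<open>Concatenation of patterns\<close>

text \<open>A pair is determined by \<open>A\<close> and the sorted list of its symmetric
  difference, which has \<open>length P\<close> entries from \<open>X\<close>.\<close>

lemma card_pattern_pairs_le:
  assumes "finite X"
  shows "card {(A, B). A \<subseteq> X \<and> B \<subseteq> X \<and> pat A B = P} \<le> card X ^ length P * 2 ^ card X"
proof -
  let ?E = "{(A, B). A \<subseteq> X \<and> B \<subseteq> X \<and> pat A B = P}"
  let ?f = "\<lambda>(A, B). (A, sorted_list_of_set (sym_diff A B))"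
  let ?T = "Pow X \<times> {xs. set xs \<subseteq> X \<and> length xs = length P}"
  have fin: "finite (sym_diff A B)" if "A \<subseteq> X" "B \<subseteq> X" for A B
    using that assms by (meson finite_Diff finite_UnI finite_subset)
  have "inj_on ?f ?E"
  proof (rule inj_onI, clarsimp)
    fix A B B'
    assume *: "A \<subseteq> X" "B \<subseteq> X" "B' \<subseteq> X"
      "sorted_list_of_set (sym_diff A B) = sorted_list_of_set (sym_diff A B')"
    then have "sym_diff A B = sym_diff A B'"
      using fin by (metis set_sorted_list_of_set)
    then show "B = B'" by blast
  qed
  moreover have "?f ` ?E \<subseteq> ?T"
    using fin by (auto simp: length_pat)
  moreover have "finite ?T" using assms by (simp add: finite_lists_length_eq)
  ultimately have "card ?E \<le> card ?T" by (rule card_inj_on_le)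
  also have "card ?T = card X ^ length P * 2 ^ card X"
    using assms by (simp add: card_cartesian_product card_lists_length_eq card_Pow)
  finally show ?thesis .
qed

text \<open>Deleting the first member of every \<open>P\<close>-pair leaves a \<open>P\<close>-free family.\<close>

lemma pattern_pairs_supersaturation:
  assumes "cube_bound P m \<alpha>" "finite X" "card X \<ge> m" "\<F> \<subseteq> Pow X"
  shows "real (card \<F>) \<le> \<alpha> * 2 ^ card X + real (card {(A, B). A \<in> \<F> \<and> B \<in> \<F> \<and> pat A B = P})"
proof -
  let ?E = "{(A, B). A \<in> \<F> \<and> B \<in> \<F> \<and> pat A B = P}"
  have finF: "finite \<F>" using assms by (meson finite_Pow_iff finite_subset)
  have finE: "finite ?E" by (rule finite_subset[of _ "\<F> \<times> \<F>"]) (use finF in auto)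
  have "pattern_free P (\<F> - fst ` ?E)"
    unfolding pattern_free_def by force
  then have "real (card (\<F> - fst ` ?E)) \<le> \<alpha> * 2 ^ card X"
    using assms by (intro cube_boundD[OF assms(1)]) auto
  moreover have "card \<F> \<le> card (\<F> - fst ` ?E) + card (fst ` ?E)"
    using diff_card_le_card_Diff[of "fst ` ?E" \<F>] finE by simp
  moreover have "card (fst ` ?E) \<le> card ?E" by (rule card_image_le[OF finE])
  ultimately show ?thesis by linarith
qed

text \<open>Hides which of \<open>X\<close> and \<open>Y\<close> lies below the other, so that one
  counting argument serves both when the shorter pattern is the first part and when it is the
  last.\<close>

definition joins :: "nat set \<Rightarrow> nat set \<Rightarrow> pattern \<Rightarrow> pattern \<Rightarrow> pattern \<Rightarrow> bool" where
  "joins X Y P1 P2 P \<longleftrightarrow> (\<forall>A B C D. A \<subseteq> X \<longrightarrow> B \<subseteq> X \<longrightarrow> C \<subseteq> Y \<longrightarrow> D \<subseteq> Y \<longrightarrow>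
     pat A B = P1 \<longrightarrow> pat C D = P2 \<longrightarrow> pat (A \<union> C) (B \<union> D) = P)"

lemma joinsD:
  assumes "joins X Y P1 P2 P" "A \<subseteq> X" "B \<subseteq> X" "C \<subseteq> Y" "D \<subseteq> Y" "pat A B = P1" "pat C D = P2"
  shows "pat (A \<union> C) (B \<union> D) = P"
  using assms unfolding joins_def by blast

lemma joins_commute: "joins X Y P1 P2 P \<longleftrightarrow> joins Y X P2 P1 P"
  unfolding joins_def by (metis Un_commute)

lemma joins_append:
  assumes "finite X" "finite Y" "\<And>x y. x \<in> X \<Longrightarrow> y \<in> Y \<Longrightarrow> x < y"
  shows "joins X Y P1 P2 (P1 @ P2)"
  unfolding joins_def using pat_append[OF assms] by blast

text \<open>Double counting of the pairs \<open>(R, e)\<close> where \<open>e\<close> is a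
  \<open>P1\<close>-pair in the fibre over \<open>R\<close>. Supersaturation gives many
  \<open>e\<close> for a large fibre, while each \<open>e\<close> has few \<open>R\<close>, because
  two such \<open>R\<close> with pattern \<open>P2\<close> would complete \<open>e\<close> to a
  \<open>P\<close>-pair.\<close>

lemma card_free_concat_le:
  assumes "cube_bound P1 (card X) \<alpha>" "cube_bound P2 (card Y) \<beta>"
    and fin: "finite X" "finite Y" and disj: "X \<inter> Y = {}"
    and "\<A> \<subseteq> Pow (X \<union> Y)" and free: "pattern_free P \<A>"
    and P: "joins X Y P1 P2 P"
  shows "real (card \<A>) \<le> (\<alpha> + real (card X) ^ length P1 * \<beta>) * 2 ^ card (X \<union> Y)"
proof -
  define \<F> where "\<F> R = {S \<in> Pow X. S \<union> R \<in> \<A>}" for R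
  define E where "E = {(A, B). A \<subseteq> X \<and> B \<subseteq> X \<and> pat A B = P1}"
  have finE: "finite E" by (rule finite_subset[of _ "Pow X \<times> Pow X"]) (use fin in \<open>auto simp: E_def\<close>)
  have link: "real (card {R \<in> Pow Y. fst e \<in> \<F> R \<and> snd e \<in> \<F> R}) \<le> \<beta> * 2 ^ card Y" if "e \<in> E" for e
  proof (rule cube_boundD[OF assms(2)])
    show "pattern_free P2 {R \<in> Pow Y. fst e \<in> \<F> R \<and> snd e \<in> \<F> R}"
      unfolding pattern_free_def
    proof (intro ballI notI)
      fix C D assume C: "C \<in> {R \<in> Pow Y. fst e \<in> \<F> R \<and> snd e \<in> \<F> R}"
        and D: "D \<in> {R \<in> Pow Y. fst e \<in> \<F> R \<and> snd e \<in> \<F> R}" and CD: "pat C D = P2"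
      have "pat (fst e \<union> C) (snd e \<union> D) = P"
        using that C D CD by (intro joinsD[OF P]) (auto simp: E_def)
      then show False using C D free by (auto simp: \<F>_def pattern_free_def)
    qed
  qed (use fin in auto)
  have "real (card \<A>) = (\<Sum>R\<in>Pow Y. real (card (\<F> R)))"
    using card_eq_sum_fibres[OF fin disj assms(6)] by (simp add: \<F>_def)
  also have "\<dots> \<le> (\<Sum>R\<in>Pow Y. \<alpha> * 2 ^ card X + real (card {e \<in> E. fst e \<in> \<F> R \<and> snd e \<in> \<F> R}))"
  proof (rule sum_mono)
    fix R
    have "{(A, B). A \<in> \<F> R \<and> B \<in> \<F> R \<and> pat A B = P1} = {e \<in> E. fst e \<in> \<F> R \<and> snd e \<in> \<F> R}"
      by (auto simp: E_def \<F>_def)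
    then show "real (card (\<F> R)) \<le> \<alpha> * 2 ^ card X + real (card {e \<in> E. fst e \<in> \<F> R \<and> snd e \<in> \<F> R})"
      using pattern_pairs_supersaturation[OF assms(1) fin(1) order.refl, of "\<F> R"] by (auto simp: \<F>_def)
  qed
  also have "\<dots> = \<alpha> * 2 ^ card X * 2 ^ card Y + real (\<Sum>R\<in>Pow Y. card {e \<in> E. fst e \<in> \<F> R \<and> snd e \<in> \<F> R})"
    using fin by (simp add: sum.distrib card_Pow)
  also have "(\<Sum>R\<in>Pow Y. card {e \<in> E. fst e \<in> \<F> R \<and> snd e \<in> \<F> R})
      = (\<Sum>e\<in>E. card {R \<in> Pow Y. fst e \<in> \<F> R \<and> snd e \<in> \<F> R})"
    using fin finE by (intro sum_multicount_gen) auto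
  also have "real \<dots> \<le> (\<Sum>e\<in>E. \<beta> * 2 ^ card Y)"
    unfolding of_nat_sum by (intro sum_mono link)
  also have "\<dots> = real (card E) * (\<beta> * 2 ^ card Y)" by simp
  also have "\<dots> \<le> real (card X ^ length P1 * 2 ^ card X) * (\<beta> * 2 ^ card Y)"
    using card_pattern_pairs_le[OF fin(1), of P1] cube_bound_nonneg[OF assms(2)]
    by (intro mult_right_mono of_nat_mono) (auto simp: E_def)
  finally show ?thesis
    using fin disj by (simp add: card_Un_disjoint power_add algebra_simps)
qed

subsection \<open>Enclosed patterns\<close>

text \<open>At most \<open>w\<close> elements are the least of their class; every other element is
  the larger member of some pair.\<close>

lemma card_le_classes_add_pairs:
  fixes N :: "nat set"
  assumes "finite N" "\<And>t. t \<in> N \<Longrightarrow> f t < (w::nat)"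
  shows "card N \<le> w + card {(t, t'). t \<in> N \<and> t' \<in> N \<and> t < t' \<and> f t = f t'}"
proof -
  let ?M = "{t \<in> N. \<forall>u\<in>N. u < t \<longrightarrow> f u \<noteq> f t}"
  let ?P = "{(t, t'). t \<in> N \<and> t' \<in> N \<and> t < t' \<and> f t = f t'}"
  have finP: "finite ?P" by (rule finite_subset[of _ "N \<times> N"]) (use assms in auto)
  have "inj_on f ?M" by (rule inj_onI) (metis (mono_tags, lifting) linorder_neqE_nat mem_Collect_eq)
  then have "card ?M \<le> card {..<w}"
    using assms by (intro card_inj_on_le[where f = f]) auto
  moreover have "N - ?M \<subseteq> snd ` ?P" by force
  then have "card (N - ?M) \<le> card ?P"
    using finP card_image_le[OF finP, of snd] card_mono[of "snd ` ?P" "N - ?M"] by simp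
  moreover have "card N \<le> card ?M + card (N - ?M)"
    using assms(1) card_Diff_subset[of ?M N] by simp
  ultimately show ?thesis by simp
qed

text \<open>Residue classes are taken of ranks, not of values, so that gaps are measured in points
  of \<open>V\<close>.\<close>

definition rank :: "nat set \<Rightarrow> nat \<Rightarrow> nat" where
  "rank V v = card {u \<in> V. u < v}"

lemma rank_less_card:
  assumes "finite V" "v \<in> V"
  shows "rank V v < card V"
  unfolding rank_def using assms by (intro psubset_card_mono) auto

lemma rank_eq_add_between:
  assumes "finite V" "t \<in> V" "t < t'"
  shows "rank V t' = rank V t + 1 + card {v \<in> V. t < v \<and> v < t'}"
proof -
  have "{u \<in> V. u < t'} = insert t ({u \<in> V. u < t} \<union> {v \<in> V. t < v \<and> v < t'})"
    using assms by auto
  moreover have "card ({u \<in> V. u < t} \<union> {v \<in> V. t < v \<and> v < t'})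
      = card {u \<in> V. u < t} + card {v \<in> V. t < v \<and> v < t'}"
    using assms by (intro card_Un_disjoint) auto
  ultimately show ?thesis using assms by (simp add: rank_def)
qed

lemma inj_on_rank:
  assumes "finite V"
  shows "inj_on (rank V) V"
proof (rule inj_onI)
  fix x y assume "x \<in> V" "y \<in> V" "rank V x = rank V y"
  then show "x = y"
    using rank_eq_add_between[of V x y] rank_eq_add_between[of V y x] assms
    by (cases x y rule: linorder_cases) auto
qed

definition rank_pairs :: "nat set \<Rightarrow> nat \<Rightarrow> (nat \<times> nat) set" where
  "rank_pairs V w = {(t, t'). t \<in> V \<and> t' \<in> V \<and> t < t' \<and> rank V t mod w = rank V t' mod w}"

lemma finite_rank_pairs: "finite V \<Longrightarrow> finite (rank_pairs V w)"
  unfolding rank_pairs_def by (rule finite_subset[of _ "V \<times> V"]) auto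

text \<open>The two ranks differ by a positive multiple of \<open>w\<close>.\<close>

lemma rank_pairs_gap:
  assumes "finite V" "(t, t') \<in> rank_pairs V w"
  shows "w - 1 \<le> card {v \<in> V. t < v \<and> v < t'}" "w \<le> rank V t'"
proof -
  have lt: "rank V t' = rank V t + 1 + card {v \<in> V. t < v \<and> v < t'}"
    using assms by (intro rank_eq_add_between) (auto simp: rank_pairs_def)
  have "w dvd rank V t' - rank V t"
    using assms lt by (intro mod_eq_dvd_iff_nat[THEN iffD1]) (auto simp: rank_pairs_def)
  then have "w \<le> rank V t' - rank V t" by (rule dvd_imp_le) (simp add: lt)
  then show "w - 1 \<le> card {v \<in> V. t < v \<and> v < t'}" "w \<le> rank V t'" using lt by linarith+
qed

text \<open>Since the residues agree, a pair is determined by the rank of \<open>t\<close> and the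
  quotient of the rank of \<open>t'\<close> by \<open>w\<close>. That quotient is at least 1, as the
  rank of \<open>t'\<close> is at least \<open>w\<close>, which leaves at most
  \<open>card V div w\<close> values.\<close>

lemma card_rank_pairs_le:
  assumes "finite V" "w \<ge> 1"
  shows "card (rank_pairs V w) * w \<le> card V ^ 2"
proof -
  let ?f = "\<lambda>(t, t'). (rank V t, rank V t' div w)"
  let ?T = "{..<card V} \<times> {1..card V div w}"
  have "inj_on ?f (rank_pairs V w)"
  proof (rule inj_onI, clarify)
    fix t t' u u' assume *: "(t, t') \<in> rank_pairs V w" "(u, u') \<in> rank_pairs V w"
      "rank V t = rank V u" "rank V t' div w = rank V u' div w"
    then have "rank V t' mod w = rank V u' mod w" by (auto simp: rank_pairs_def)
    then have "rank V t' = rank V u'" using * by (metis div_mult_mod_eq)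
    then show "t = u \<and> t' = u'"
      using * inj_onD[OF inj_on_rank[OF assms(1)]] by (auto simp: rank_pairs_def)
  qed
  moreover have "?f ` rank_pairs V w \<subseteq> ?T"
  proof clarify
    fix t t' assume *: "(t, t') \<in> rank_pairs V w"
    then have "t \<in> V" "t' \<in> V" by (auto simp: rank_pairs_def)
    then have "rank V t < card V" "rank V t' < card V" using assms rank_less_card by auto
    moreover have "1 \<le> rank V t' div w"
      using rank_pairs_gap(2)[OF assms(1) *] assms(2) by (simp add: Suc_le_eq div_greater_zero_iff)
    ultimately show "rank V t \<in> {..<card V} \<and> rank V t' div w \<in> {1..card V div w}"
      by (simp add: div_le_mono)
  qed
  ultimately have "card (rank_pairs V w) \<le> card ?T" by (intro card_inj_on_le) auto
  also have "\<dots> = card V * (card V div w)" by (simp add: card_cartesian_product)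
  finally have "card (rank_pairs V w) * w \<le> card V * (card V div w) * w" by simp
  also have "\<dots> \<le> card V * card V" by (simp add: mult.assoc)
  finally show ?thesis by (simp add: power2_eq_square)
qed

text \<open>Fix the part \<open>R\<close> of \<open>S\<close> outside the open interval between
  \<open>t\<close> and \<open>t'\<close>. A \<open>Q\<close>-pair inside the interval becomes a
  forbidden pair when \<open>t\<close> is added to one member and \<open>t'\<close> to the
  other.\<close>

lemma card_link_enclosed_le:
  assumes "cube_bound Q m \<beta>" "finite V" "pattern_free (s # Q @ [flip s]) \<A>"
    and t: "t \<in> V" "t' \<in> V" "t < t'" and m: "m \<le> card {v \<in> V. t < v \<and> v < t'}"
  shows "real (card {S \<in> Pow V. t \<notin> S \<and> t' \<notin> S \<and> insert t S \<in> \<A> \<and> insert t' S \<in> \<A>}) \<le> \<beta> * 2 ^ card V"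
    (is "real (card ?\<B>) \<le> _")
proof -
  let ?I = "{v \<in> V. t < v \<and> v < t'}"
  have fin: "finite ?I" "finite (V - ?I)" using assms by auto
  have V: "?I \<union> (V - ?I) = V" by auto
  have sub: "?\<B> \<subseteq> Pow (?I \<union> (V - ?I))" unfolding V by auto
  have "real (card ?\<B>) = (\<Sum>R\<in>Pow (V - ?I). real (card {S \<in> Pow ?I. S \<union> R \<in> ?\<B>}))"
    using arg_cong[OF card_eq_sum_fibres[OF fin _ sub], of real] by (simp only: of_nat_sum) auto
  also have "\<dots> \<le> (\<Sum>R\<in>Pow (V - ?I). \<beta> * 2 ^ card ?I)"
  proof (intro sum_mono cube_boundD[OF assms(1) fin(1) m])
    fix R assume R: "R \<in> Pow (V - ?I)"
    show "pattern_free Q {S \<in> Pow ?I. S \<union> R \<in> ?\<B>}"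
      unfolding pattern_free_def
    proof (intro ballI notI)
      fix S S' assume S: "S \<in> {S \<in> Pow ?I. S \<union> R \<in> ?\<B>}" and S': "S' \<in> {S \<in> Pow ?I. S \<union> R \<in> ?\<B>}"
        and Q: "pat S S' = Q"
      have I: "S \<subseteq> ?I" "S' \<subseteq> ?I" using S S' by auto
      have tR: "t \<notin> R" "t' \<notin> R" using S by auto
      \<comment> \<open>The four sets \<open>A\<close>, \<open>B\<close>, \<open>C\<close>,
        \<open>D\<close> say which member receives \<open>t\<close> and which \<open>t'\<close>; the
        two signs of \<open>s\<close> are two instances.\<close>
      have sand: "pat ((A \<union> S \<union> C) \<union> R) ((B \<union> S' \<union> D) \<union> R) = pat A B @ Q @ pat C D"
        if "A \<subseteq> {t}" "B \<subseteq> {t}" "C \<subseteq> {t'}" "D \<subseteq> {t'}" for A B C D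
      proof -
        have "pat ((A \<union> S \<union> C) \<union> R) ((B \<union> S' \<union> D) \<union> R) = pat (A \<union> S \<union> C) (B \<union> S' \<union> D)"
          using R tR I that by (intro pat_Un_common) blast
        also have "\<dots> = pat (A \<union> (S \<union> C)) (B \<union> (S' \<union> D))" by (simp add: Un_assoc)
        also have "\<dots> = pat A B @ pat (S \<union> C) (S' \<union> D)"
          using fin I that t(3) by (intro pat_append[of "{t}" "?I \<union> {t'}"]) (simp, simp, force, blast+)
        also have "pat (S \<union> C) (S' \<union> D) = pat S S' @ pat C D"
          using fin I that by (intro pat_append[of ?I "{t'}"]) auto
        finally show ?thesis using Q by simp
      qed
      show False
      proof (cases s)
        case SPlus
        have "pat (insert t (S \<union> R)) (insert t' (S' \<union> R)) = s # Q @ [flip s]"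
          using sand[of "{t}" "{}" "{}" "{t'}"] SPlus by (simp add: insert_commute)
        then show False using S S' assms(3) by (auto simp: pattern_free_def)
      next
        case SMinus
        have "pat (insert t' (S \<union> R)) (insert t (S' \<union> R)) = s # Q @ [flip s]"
          using sand[of "{}" "{t}" "{t'}" "{}"] SMinus by (simp add: insert_commute)
        then show False using S S' assms(3) by (auto simp: pattern_free_def)
      qed
    qed
  qed auto
  also have "\<dots> = \<beta> * 2 ^ (card ?I + card (V - ?I))"
    using fin by (simp add: card_Pow power_add)
  also have "card ?I + card (V - ?I) = card V"
    using card_Un_disjoint[OF fin] V by auto
  finally show ?thesis .
qed

text \<open>An incidence \<open>t \<in> A\<close> is counted from \<open>S = A - {t}\<close>. Each
  \<open>S\<close> has at most \<open>w\<close> such \<open>t\<close> plus the number of rank pairs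
  whose link contains \<open>S\<close>, and each of the at most \<open>card V ^ 2 / w\<close> rank
  pairs has a sparse link.\<close>

lemma sum_card_free_enclosed_le:
  assumes "cube_bound Q (w - 1) \<beta>" "finite V" "\<A> \<subseteq> Pow V" "pattern_free (s # Q @ [flip s]) \<A>" "w \<ge> 1"
  shows "real (\<Sum>A\<in>\<A>. card A) \<le> (real w + real (card V) ^ 2 / real w * \<beta>) * 2 ^ card V"
proof -
  define N where "N S = {t \<in> V - S. insert t S \<in> \<A>}" for S
  define \<B> where "\<B> g = {S \<in> Pow V. fst g \<notin> S \<and> snd g \<notin> S \<and> insert (fst g) S \<in> \<A> \<and> insert (snd g) S \<in> \<A>}" for g
  let ?G = "rank_pairs V w"
  have finA: "finite \<A>" using assms by (meson finite_Pow_iff finite_subset)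
  have finG: "finite ?G" by (rule finite_rank_pairs[OF assms(2)])
  have "(\<Sum>A\<in>\<A>. card A) = card (SIGMA A:\<A>. A)"
    using finA assms by (intro card_SigmaI[symmetric]) (auto intro: finite_subset)
  also have "\<dots> = card (SIGMA S:Pow V. N S)"
    by (rule bij_betw_same_card, rule bij_betw_byWitness[where f = "\<lambda>(A, t). (A - {t}, t)" and f' = "\<lambda>(S, t). (insert t S, t)"])
       (use assms(3) in \<open>auto simp: N_def insert_absorb\<close>)
  also have "\<dots> = (\<Sum>S\<in>Pow V. card (N S))"
    using assms(2) by (intro card_SigmaI) (auto simp: N_def)
  finally have eq: "(\<Sum>A\<in>\<A>. card A) = (\<Sum>S\<in>Pow V. card (N S))" .
  have "card (N S) \<le> w + card {g \<in> ?G. S \<in> \<B> g}" if "S \<in> Pow V" for S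
  proof -
    have "card (N S) \<le> w + card {(t, t'). t \<in> N S \<and> t' \<in> N S \<and> t < t' \<and> rank V t mod w = rank V t' mod w}"
      using assms by (intro card_le_classes_add_pairs) (auto simp: N_def)
    also have "{(t, t'). t \<in> N S \<and> t' \<in> N S \<and> t < t' \<and> rank V t mod w = rank V t' mod w} = {g \<in> ?G. S \<in> \<B> g}"
      using that by (auto simp: N_def \<B>_def rank_pairs_def)
    finally show ?thesis .
  qed
  then have "(\<Sum>S\<in>Pow V. card (N S)) \<le> (\<Sum>S\<in>Pow V. w + card {g \<in> ?G. S \<in> \<B> g})"
    by (rule sum_mono)
  also have "\<dots> = w * 2 ^ card V + (\<Sum>S\<in>Pow V. card {g \<in> ?G. S \<in> \<B> g})"
    using assms(2) by (simp add: sum.distrib card_Pow)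
  also have "(\<Sum>S\<in>Pow V. card {g \<in> ?G. S \<in> \<B> g}) = (\<Sum>g\<in>?G. card {S \<in> Pow V. S \<in> \<B> g})"
    using assms(2) finG by (intro sum_multicount_gen) auto
  also have "\<dots> = (\<Sum>g\<in>?G. card (\<B> g))" by (intro sum.cong arg_cong[where f = card]) (auto simp: \<B>_def)
  finally have "real (\<Sum>A\<in>\<A>. card A) \<le> real (w * 2 ^ card V + (\<Sum>g\<in>?G. card (\<B> g)))"
    unfolding eq by (rule of_nat_mono)
  also have "\<dots> = real w * 2 ^ card V + (\<Sum>g\<in>?G. real (card (\<B> g)))" by simp
  also have "(\<Sum>g\<in>?G. real (card (\<B> g))) \<le> (\<Sum>g\<in>?G. \<beta> * 2 ^ card V)"
  proof (rule sum_mono)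
    fix g assume g: "g \<in> ?G"
    then show "real (card (\<B> g)) \<le> \<beta> * 2 ^ card V"
      using card_link_enclosed_le[OF assms(1,2,4), of "fst g" "snd g"] rank_pairs_gap(1)[OF assms(2), of "fst g" "snd g" w]
      by (auto simp: \<B>_def rank_pairs_def)
  qed
  also have "\<dots> = real (card ?G) * (\<beta> * 2 ^ card V)" by simp
  also have "\<dots> \<le> real (card V) ^ 2 / real w * (\<beta> * 2 ^ card V)"
  proof (rule mult_right_mono)
    have "real (card ?G * w) \<le> real (card V ^ 2)"
      by (rule of_nat_mono, rule card_rank_pairs_le[OF assms(2,5)])
    then show "real (card ?G) \<le> real (card V) ^ 2 / real w" using assms(5) by (simp add: field_simps)
  qed (use cube_bound_nonneg[OF assms(1)] in simp)
  finally show ?thesis by (simp add: algebra_simps)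
qed

text \<open>The previous bound is applied to \<open>\<A>\<close> and to the family of complements: on average over the
  two families, sets have at least \<open>card V / 2\<close> elements.\<close>

lemma card_free_enclosed_le:
  assumes "cube_bound Q (w - 1) \<beta>" "finite V" "\<A> \<subseteq> Pow V" "pattern_free (s # Q @ [flip s]) \<A>" "w \<ge> 1"
    and "V \<noteq> {}"
  shows "real (card \<A>) \<le> (2 * real w / real (card V) + 2 * real (card V) / real w * \<beta>) * 2 ^ card V"
proof -
  let ?\<C> = "(\<lambda>A. V - A) ` \<A>"
  have inj: "inj_on (\<lambda>A. V - A) \<A>" using assms(3) by (intro inj_onI) blast
  have "pattern_free (s # Q @ [flip s]) ?\<C>"
    using assms(4) unfolding pattern_free_def
    using pat_compl[OF assms(2)] assms(3) by (simp add: subset_eq)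
  then have le_compl: "real (\<Sum>A\<in>?\<C>. card A) \<le> (real w + real (card V) ^ 2 / real w * \<beta>) * 2 ^ card V"
    using assms by (intro sum_card_free_enclosed_le) auto
  have le: "real (\<Sum>A\<in>\<A>. card A) \<le> (real w + real (card V) ^ 2 / real w * \<beta>) * 2 ^ card V"
    using assms by (intro sum_card_free_enclosed_le)
  have "(\<Sum>A\<in>\<A>. card A) + (\<Sum>A\<in>?\<C>. card A) = (\<Sum>A\<in>\<A>. card A + card (V - A))"
    by (simp add: sum.reindex[OF inj] sum.distrib)
  also have "\<dots> = (\<Sum>A\<in>\<A>. card V)"
  proof (rule sum.cong[OF refl])
    fix A assume "A \<in> \<A>"
    then have "A \<subseteq> V" using assms(3) by auto
    then show "card A + card (V - A) = card V" using assms(2)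
      by (simp add: card_Diff_subset card_mono finite_subset)
  qed
  finally have "real (card \<A> * card V) = real (\<Sum>A\<in>\<A>. card A) + real (\<Sum>A\<in>?\<C>. card A)"
    by (simp only: of_nat_add[symmetric]) simp
  then have "real (card \<A>) * real (card V) \<le> 2 * ((real w + real (card V) ^ 2 / real w * \<beta>) * 2 ^ card V)"
    using le le_compl unfolding of_nat_mult by linarith
  moreover have "real (card V) > 0" using assms by (simp add: card_gt_0_iff)
  ultimately show ?thesis using assms(5) by (simp add: field_simps power2_eq_square)
qed

subsection \<open>From the layers to the cube\<close>

text \<open>Choose the \<open>j\<close> points inside \<open>A\<close> and the \<open>k - j\<close>
  points outside. The count is the same for every \<open>A\<close>, so averaging over
  \<open>U\<close> weighs all members of a family equally.\<close>

lemma card_subsets_with_Int: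
  assumes "finite X" "A \<subseteq> X" "card A = k" "j \<le> k"
  shows "card {U. U \<subseteq> X \<and> card U = k \<and> card (A \<inter> U) = j} = (k choose j) * ((card X - k) choose (k - j))"
proof -
  have finA: "finite A" using assms finite_subset by blast
  have "card {U. U \<subseteq> X \<and> card U = k \<and> card (A \<inter> U) = j}
      = card ({B. B \<subseteq> A \<and> card B = j} \<times> {C. C \<subseteq> X - A \<and> card C = k - j})"
  proof (rule bij_betw_same_card[OF bij_betw_byWitness[where f = "\<lambda>U. (A \<inter> U, U - A)" and f' = "\<lambda>(B, C). B \<union> C"]])
    show "(\<lambda>U. (A \<inter> U, U - A)) ` {U. U \<subseteq> X \<and> card U = k \<and> card (A \<inter> U) = j}
        \<subseteq> {B. B \<subseteq> A \<and> card B = j} \<times> {C. C \<subseteq> X - A \<and> card C = k - j}"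
    proof (rule image_subsetI)
      fix U assume "U \<in> {U. U \<subseteq> X \<and> card U = k \<and> card (A \<inter> U) = j}"
      moreover have "card (U - A) = card U - card (A \<inter> U)"
        using finA by (subst card_Diff_subset_Int) (auto simp: Int_commute)
      ultimately show "(A \<inter> U, U - A) \<in> {B. B \<subseteq> A \<and> card B = j} \<times> {C. C \<subseteq> X - A \<and> card C = k - j}"
        by auto
    qed
    show "(\<lambda>(B, C). B \<union> C) ` ({B. B \<subseteq> A \<and> card B = j} \<times> {C. C \<subseteq> X - A \<and> card C = k - j})
        \<subseteq> {U. U \<subseteq> X \<and> card U = k \<and> card (A \<inter> U) = j}"
    proof clarify
      fix B C assume B: "B \<subseteq> A" "j = card B" and C: "C \<subseteq> X - A" "card C = k - card B"
      then have "card (B \<union> C) = card B + card C"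
        using finA assms by (intro card_Un_disjoint) (auto intro: finite_subset)
      moreover have "A \<inter> (B \<union> C) = B" using B C by auto
      ultimately show "B \<union> C \<subseteq> X \<and> card (B \<union> C) = k \<and> card (A \<inter> (B \<union> C)) = card B"
        using B C assms by auto
    qed
  qed auto
  also have "\<dots> = (k choose j) * ((card X - k) choose (k - j))"
    using assms finA by (simp add: card_cartesian_product n_subsets card_Diff_subset)
  finally show ?thesis .
qed

text \<open>Pigeonhole over the sets \<open>A - U\<close>, which are \<open>(k - j)\<close>-subsets
  of \<open>X - U\<close>. There is at least one such subset because
  \<open>k - j \<le> card X - k\<close>.\<close>

lemma exists_large_link:
  assumes "finite X" "U \<subseteq> X" "card U = k" "2 * k \<le> card X" "j \<le> k"
    and \<A>: "\<A> \<subseteq> {A. A \<subseteq> X \<and> card A = k}"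
  shows "\<exists>T. T \<subseteq> X - U \<and> card {A \<in> \<A>. card (A \<inter> U) = j}
       \<le> ((card X - k) choose (k - j)) * card {B. B \<subseteq> U \<and> card B = j \<and> B \<union> T \<in> \<A>}"
proof (rule ccontr)
  let ?F = "\<lambda>T. {B. B \<subseteq> U \<and> card B = j \<and> B \<union> T \<in> \<A>}"
  let ?Ts = "{T. T \<subseteq> X - U \<and> card T = k - j}"
  let ?N = "card {A \<in> \<A>. card (A \<inter> U) = j}"
  assume "\<not> ?thesis"
  then have less: "((card X - k) choose (k - j)) * card (?F T) < ?N" if "T \<subseteq> X - U" for T
    using that by (meson not_le)
  have finU: "finite U" using assms finite_subset by blast
  have cardT: "card ?Ts = (card X - k) choose (k - j)"
    using assms finU by (simp add: n_subsets card_Diff_subset)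
  have finT: "finite ?Ts" using assms(1) by simp
  have "card {A \<in> \<A>. card (A \<inter> U) = j} \<le> card (SIGMA T:?Ts. ?F T)"
  proof (rule card_inj_on_le[where f = "\<lambda>A. (A - U, A \<inter> U)"])
    show "inj_on (\<lambda>A. (A - U, A \<inter> U)) {A \<in> \<A>. card (A \<inter> U) = j}" by (rule inj_onI) blast
    show "(\<lambda>A. (A - U, A \<inter> U)) ` {A \<in> \<A>. card (A \<inter> U) = j} \<subseteq> (SIGMA T:?Ts. ?F T)"
    proof (rule image_subsetI)
      fix A assume A: "A \<in> {A \<in> \<A>. card (A \<inter> U) = j}"
      then have "A \<subseteq> X" "card A = k" using \<A> by auto
      moreover have "card (A - U) = card A - card (A \<inter> U)"
        using finU by (subst card_Diff_subset_Int) auto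
      moreover have "A \<inter> U \<union> (A - U) = A" by blast
      ultimately show "(A - U, A \<inter> U) \<in> (SIGMA T:?Ts. ?F T)" using A by auto
    qed
    show "finite (SIGMA T:?Ts. ?F T)" using finT finU by simp
  qed
  also have "\<dots> = (\<Sum>T\<in>?Ts. card (?F T))"
    using finT finU by (intro card_SigmaI) auto
  finally have "card ?Ts * ?N \<le> (\<Sum>T\<in>?Ts. card ?Ts * card (?F T))"
    by (simp only: sum_distrib_left[symmetric] mult_le_mono2)
  also have "\<dots> < (\<Sum>T\<in>?Ts. ?N)"
  proof (rule sum_strict_mono[OF finT])
    have "card ?Ts > 0" unfolding cardT using assms by (simp add: zero_less_binomial)
    then show "?Ts \<noteq> {}" by force
  qed (use less cardT in auto)
  finally show False by simp
qed

text \<open>For each \<open>k\<close>-set \<open>U\<close>, every layer of the cube \<open>Pow U\<close> is moved into the \<open>k\<close>-th layer by adding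
  its own set \<open>T U j\<close>. As pairs of a balanced pattern lie in one layer, the preimage of \<open>\<A>\<close> is
  \<open>P\<close>-free in \<open>Pow U\<close>; averaging over \<open>U\<close> compares the densities.\<close>

lemma card_free_layer_le:
  assumes "cube_bound P k \<beta>" "balanced d P" "d \<ge> 1" "2 * k \<le> n"
    and "\<A> \<subseteq> layer n k" "pattern_free P \<A>"
  shows "real (card \<A>) \<le> \<beta> * real (n choose k)"
proof -
  let ?X = "{1..n}"
  have \<A>: "\<A> \<subseteq> {A. A \<subseteq> ?X \<and> card A = k}" using assms by (simp add: layer_def)
  have finA: "finite \<A>" using finite_layer assms(5) finite_subset by blast
  define F where "F T U j = {B. B \<subseteq> U \<and> card B = j \<and> B \<union> T \<in> \<A>}" for T U j
  have "\<exists>T. T \<subseteq> ?X - U \<and> card {A \<in> \<A>. card (A \<inter> U) = j} \<le> ((n - k) choose (k - j)) * card (F T U j)"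
    if "U \<in> layer n k" "j \<le> k" for U j
    using that exists_large_link[of ?X U k j \<A>] \<A> assms(4) by (simp add: layer_def F_def)
  then have "\<forall>U j. \<exists>T. U \<in> layer n k \<longrightarrow> j \<le> k \<longrightarrow>
      T \<subseteq> ?X - U \<and> card {A \<in> \<A>. card (A \<inter> U) = j} \<le> ((n - k) choose (k - j)) * card (F T U j)"
    by blast
  from choice[OF allI[OF choice[OF spec[OF this]]]] obtain T
    where T': "\<forall>U j. U \<in> layer n k \<longrightarrow> j \<le> k \<longrightarrow> T U j \<subseteq> ?X - U \<and>
      card {A \<in> \<A>. card (A \<inter> U) = j} \<le> ((n - k) choose (k - j)) * card (F (T U j) U j)"
    by (rule exE)
  have T: "T U j \<subseteq> ?X - U"
    and le: "card {A \<in> \<A>. card (A \<inter> U) = j} \<le> ((n - k) choose (k - j)) * card (F (T U j) U j)"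
    if "U \<in> layer n k" "j \<le> k" for U j
    using T' that by simp_all
  define G where "G U = (\<Union>j\<le>k. F (T U j) U j)" for U
  have cardU: "card U = k" "finite U" if "U \<in> layer n k" for U
    using that by (auto simp: layer_def intro: finite_subset)
  have cube: "real (card (G U)) \<le> \<beta> * 2 ^ k" if U: "U \<in> layer n k" for U
  proof -
    have "pattern_free P (G U)"
      unfolding pattern_free_def
    proof (intro ballI notI)
      fix A B assume A: "A \<in> G U" and B: "B \<in> G U" and P: "pat A B = P"
      have sub: "A \<subseteq> U" "B \<subseteq> U" using A B by (auto simp: G_def F_def)
      then have "finite A" "finite B" using cardU[OF U] finite_subset by auto
      then have card: "card A = card B" using pat_balanced_card[of A B d] P assms(2) by simp
      have j: "card A \<le> k" using card_mono[of U A] sub cardU[OF U] by simp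
      have "A \<union> T U (card A) \<in> \<A>" "B \<union> T U (card A) \<in> \<A>"
        using A B card by (auto simp: G_def F_def)
      moreover have "pat (A \<union> T U (card A)) (B \<union> T U (card A)) = P"
        using pat_Un_common[of "T U (card A)" A B] T[OF U j] sub P by blast
      ultimately show False using assms(6) by (simp add: pattern_free_def)
    qed
    moreover have "G U \<subseteq> Pow U" by (auto simp: G_def F_def)
    ultimately show ?thesis using cube_boundD[OF assms(1), of U "G U"] cardU[OF U] by simp
  qed
  have cardG: "card (G U) = (\<Sum>j\<le>k. card (F (T U j) U j))" if U: "U \<in> layer n k" for U
    unfolding G_def using cardU[OF U] by (intro card_UN_disjoint) (auto simp: F_def)
  \<comment> \<open>The factor \<open>?c\<close> enters on the left from counting the sets
    \<open>U\<close> that meet \<open>A\<close> in \<open>j\<close> points and on the right from the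
    pigeonhole loss in \<open>le\<close>, so it cancels.\<close>
  have layer: "card \<A> * (k choose j) \<le> (\<Sum>U\<in>layer n k. card (F (T U j) U j))" if j: "j \<le> k" for j
  proof -
    let ?c = "(n - k) choose (k - j)"
    have "card \<A> * ((k choose j) * ?c) = (\<Sum>A\<in>\<A>. card {U \<in> layer n k. card (A \<inter> U) = j})"
    proof -
      have "card {U \<in> layer n k. card (A \<inter> U) = j} = (k choose j) * ?c" if "A \<in> \<A>" for A
        using card_subsets_with_Int[of ?X A k j] that \<A> j by (auto simp: layer_def conj_assoc)
      then show ?thesis by simp
    qed
    also have "\<dots> = (\<Sum>U\<in>layer n k. card {A \<in> \<A>. card (A \<inter> U) = j})"
      using finA finite_layer by (intro sum_multicount_gen) auto
    also have "\<dots> \<le> (\<Sum>U\<in>layer n k. ?c * card (F (T U j) U j))"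
      by (intro sum_mono le j)
    also have "\<dots> = ?c * (\<Sum>U\<in>layer n k. card (F (T U j) U j))" by (simp add: sum_distrib_left)
    finally have "?c * (card \<A> * (k choose j)) \<le> ?c * (\<Sum>U\<in>layer n k. card (F (T U j) U j))"
      by (simp add: ac_simps)
    moreover have "?c > 0" using assms(4) by (simp add: zero_less_binomial)
    ultimately show ?thesis by simp
  qed
  \<comment> \<open>The weights \<open>k choose j\<close> left by the cancellation are exactly the
    layer sizes of a \<open>k\<close>-dimensional cube.\<close>
  have "card \<A> * 2 ^ k = (\<Sum>j\<le>k. card \<A> * (k choose j))"
    by (simp add: choose_row_sum flip: sum_distrib_left)
  also have "\<dots> \<le> (\<Sum>j\<le>k. \<Sum>U\<in>layer n k. card (F (T U j) U j))"
    by (intro sum_mono layer) simp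
  also have "\<dots> = (\<Sum>U\<in>layer n k. card (G U))"
    by (subst sum.swap) (simp add: cardG)
  finally have "real (card \<A> * 2 ^ k) \<le> real (\<Sum>U\<in>layer n k. card (G U))" by (rule of_nat_mono)
  also have "\<dots> \<le> (\<Sum>U\<in>layer n k. \<beta> * 2 ^ k)"
    unfolding of_nat_sum by (intro sum_mono cube)
  also have "\<dots> = real (n choose k) * (\<beta> * 2 ^ k)"
    using n_subsets[of ?X k] by (simp add: layer_def)
  finally show ?thesis by (simp add: mult.commute)
qed

subsection \<open>Exponents and constants\<close>

definition a_const :: "nat \<Rightarrow> real" where
  "a_const d = (8 * real d) ^ (5 * d)"

definition c_const :: "nat \<Rightarrow> real" where
  "c_const d = 6 * real d / 8 ^ d"

lemma a_const_ge_1: "a_const d \<ge> 1"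
  \<comment> \<open>For \<open>d = 0\<close> the value is \<open>0 ^ 0 = 1\<close>.\<close>
  by (cases d) (auto simp: a_const_def intro!: one_le_power)

text \<open>Supplies the constants lost in a recursion step: the new base \<open>8 * (e + f)\<close>
  is at least \<open>8 * f\<close>, and at least 8 when \<open>e \<ge> 1\<close>.\<close>

lemma a_const_add_ge: "8 ^ (5 * e) * a_const f \<le> a_const (e + f)"
proof (cases "e = 0")
  case False
  have "8 ^ (5 * e) * (8 * real f) ^ (5 * f) \<le> (8 * real (e + f)) ^ (5 * e) * (8 * real (e + f)) ^ (5 * f)"
    using False by (intro mult_mono power_mono) auto
  then show ?thesis by (simp add: a_const_def power_add distrib_left)
qed simp

lemma c_const_pos: "d \<ge> 1 \<Longrightarrow> c_const d > 0"
  by (simp add: c_const_def)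

lemma c_const_Suc_le:
  assumes "d \<ge> 1"
  shows "c_const (Suc d) \<le> c_const d / 4"
  using assms by (simp add: c_const_def field_simps)

lemma c_const_antimono:
  assumes "1 \<le> d" "d \<le> e"
  shows "c_const e \<le> c_const d"
  using assms(2)
proof (induction rule: dec_induct)
  case (step i)
  then show ?case using c_const_Suc_le[of i] c_const_pos[of i] assms by simp
qed simp

lemma c_const_le_1:
  assumes "d \<ge> 1"
  shows "c_const d \<le> 1"
proof -
  have "c_const 1 = 3 / 4" by (simp add: c_const_def)
  then show ?thesis using c_const_antimono[of 1 d] assms by simp
qed

text \<open>Concatenation divides the exponent by \<open>1 + 2 * e / c_const e\<close>, which equals
  \<open>1 + 8 ^ e / 3\<close>. With \<open>e + f \<le> 2 * f\<close> and
  \<open>8 ^ e \<ge> 8\<close> the left side is at most 11/12 of the right.\<close>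

lemma c_const_add_le:
  assumes "1 \<le> e" "e \<le> f"
  shows "c_const (e + f) * (1 + 2 * real e / c_const e) \<le> c_const f"
proof -
  have pow: "(8::real) ^ 1 \<le> 8 ^ e" using assms by (intro power_increasing) auto
  have "c_const (e + f) * (1 + 2 * real e / c_const e) = 6 / 8 ^ f * (real (e + f) * (1 / 8 ^ e + 1 / 3))"
    using assms by (simp add: c_const_def power_add field_simps)
  also have "\<dots> \<le> 6 / 8 ^ f * ((2 * real f) * (1 / 8 + 1 / 3))"
    using assms pow by (intro mult_left_mono mult_mono add_mono) (auto simp: field_simps)
  also have "\<dots> \<le> 6 / 8 ^ f * real f"
    by (intro mult_left_mono) auto
  finally show ?thesis by (simp add: c_const_def)
qed

text \<open>The choice \<open>w \<approx> M D / 4\<close> makes the first summand at most \<open>D / 2\<close>.\<close>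

lemma enclosed_recursion:
  fixes A C a c :: real and M :: nat
  assumes "a \<ge> 1" "0 \<le> c" "c \<le> 1" "256 * a \<le> A" "4 * C \<le> c" "M \<ge> 1"
    and D: "D = A * real M powr (- C)" "D < 1"
  shows "\<exists>w\<ge>2. 2 * real w / real M + 2 * real M / real w * (a * real (w - 1) powr (- c)) \<le> D"
proof -
  have M: "real M \<ge> 1" and A: "A \<ge> 256" using assms by auto
  have D0: "D > 0" using M A D by simp
  have "A * 1 \<le> A * real M powr (1 - C)"
    using A M assms by (intro mult_left_mono ge_one_powr_ge_zero) auto
  also have "\<dots> = real M * D" using M by (simp add: D(1) powr_diff powr_minus field_simps)
  finally have MD: "real M * D \<ge> 256" using A by simp
  define w where "w = nat \<lfloor>real M * D / 4\<rfloor>"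
  have w_eq: "real w = real_of_int \<lfloor>real M * D / 4\<rfloor>" using MD by (simp add: w_def)
  have w_le: "real w \<le> real M * D / 4" unfolding w_eq by (rule of_int_floor_le)
  \<comment> \<open>The bound 256 on \<open>M * D\<close> absorbs both the rounding and the extra 1,
    which pays for the later passage to \<open>w - 1\<close>.\<close>
  have w_ge: "real w \<ge> real M * D / 8 + 1" unfolding w_eq using MD by linarith
  then have w2: "w \<ge> 2" using MD by linarith
  have "real (w - 1) powr (- c) \<le> (real M * (D / 8)) powr (- c)"
    using w_ge MD assms w2 by (intro powr_mono2') auto
  also have "\<dots> = real M powr (- c) * (D / 8) powr (- c)"
    by (rule powr_mult)
  also have "\<dots> \<le> real M powr (- c) * (D / 8) powr (- 1)"
    using D D0 assms by (intro mult_left_mono powr_mono') auto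
  also have "\<dots> = real M powr (- c) * (8 / D)" using D0 by (simp add: powr_minus)
  finally have pw: "real (w - 1) powr (- c) \<le> real M powr (- c) * (8 / D)" .
  \<comment> \<open>The factors \<open>M / w\<close> and \<open>(w - 1) powr (- c)\<close> together
    lose a factor of order \<open>D ^ 2\<close>, so \<open>a * M powr (- c)\<close> must be of order
    \<open>D ^ 3\<close>; the hypothesis \<open>4 * C \<le> c\<close> even gives
    \<open>D ^ 4\<close>.\<close>
  have "256 * a * real M powr (- c) \<le> A ^ 4 * real M powr (- (4 * C))"
  proof (intro mult_mono powr_mono)
    have "A ^ 1 \<le> A ^ 4" using A by (intro power_increasing) auto
    then show "256 * a \<le> A ^ 4" using assms by simp
  qed (use M A assms in auto)
  also have "\<dots> = D ^ 4"
    using powr_powr[of "real M" "- C" 4] by (simp add: D(1) power_mult_distrib mult.commute)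
  also have "\<dots> \<le> D ^ 3" using D D0 by (intro power_decreasing) auto
  finally have key: "256 * a * real M powr (- c) \<le> D ^ 3" .
  have "real M / real w \<le> 8 / D"
    using w_ge w2 D0 M by (simp add: field_simps)
  then have "2 * (real M / real w) * (a * real (w - 1) powr (- c)) \<le> 2 * (8 / D) * (a * (real M powr (- c) * (8 / D)))"
    using assms pw D0 by (intro mult_mono) auto
  also have "\<dots> = (256 * a * real M powr (- c)) / (2 * D ^ 2)" by (simp add: power2_eq_square)
  also have "\<dots> \<le> D ^ 3 / (2 * D ^ 2)" using key D0 by (intro divide_right_mono) auto
  also have "\<dots> = D / 2" using D0 by (simp add: power3_eq_cube power2_eq_square)
  finally have "2 * real M / real w * (a * real (w - 1) powr (- c)) \<le> D / 2" by simp
  moreover have "2 * real w / real M \<le> D / 2" using w_le M by (simp add: field_simps)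
  ultimately show ?thesis using w2 by (intro exI[of _ w]) auto
qed

text \<open>The choice \<open>l \<approx> (2 a / D) powr (1 / c)\<close> makes the first summand at most \<open>D / 2\<close>.\<close>

lemma concat_recursion:
  fixes A C a c a' c' :: real and M d :: nat
  assumes "a \<ge> 1" "0 < c" "c \<le> 1" "a' \<ge> 1" "0 \<le> c'" "c' \<le> 1" "8 * a \<le> A" "4 ^ (d + 1) * a' \<le> A"
    and "C \<le> c" "0 \<le> C" "C * (1 + 2 * real d / c) \<le> c'" "M \<ge> 1"
    and D: "D = A * real M powr (- C)" "D < 1"
  shows "\<exists>l\<ge>1. 2 * l \<le> M \<and>
    a * real l powr (- c) + real l ^ (2 * d) * (a' * real (M - l) powr (- c')) \<le> D"
proof -
  have M: "real M \<ge> 1" and A: "A > 0" using assms by auto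
  have D0: "D > 0" using M A D by simp
  define X where "X = (2 * a / D) powr (1 / c)"
  define l where "l = nat \<lceil>X\<rceil>"
  have X1: "X \<ge> 1" unfolding X_def using assms D D0 by (intro ge_one_powr_ge_zero) (auto simp: field_simps)
  have l_ge: "real l \<ge> X" by (simp add: l_def real_nat_ceiling_ge)
  have "real l \<le> X + 1" using X1 by (simp add: l_def)
  then have l_le: "real l \<le> 2 * X" using X1 by simp
  have l1: "l \<ge> 1" using l_ge X1 by linarith
  \<comment> \<open>From \<open>8 * a \<le> A\<close> and \<open>C \<le> c\<close> this ratio is at
    most \<open>M powr c / 4\<close>, hence \<open>X \<le> M / 4\<close> and
    \<open>l \<le> 2 * X \<le> M / 2\<close>.\<close>
  have "2 * a / D = 2 * a / A * real M powr C" using M by (simp add: D(1) powr_minus field_simps)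
  also have "\<dots> \<le> 1 / 4 * real M powr c" using assms A M
    by (intro mult_mono powr_mono) (auto simp: field_simps)
  finally have "X \<le> (1 / 4 * real M powr c) powr (1 / c)"
    unfolding X_def using assms D0 by (intro powr_mono2) auto
  also have "\<dots> = (1 / 4) powr (1 / c) * real M" using assms M
    by (subst powr_mult) (simp_all add: powr_powr)
  also have "\<dots> \<le> (1 / 4) powr 1 * real M" using assms
    by (intro mult_right_mono powr_mono') (auto simp: field_simps)
  finally have l_half: "2 * l \<le> M" using l_le by simp
  have "real l powr (- c) \<le> X powr (- c)" using l_ge X1 assms by (intro powr_mono2') auto
  also have "\<dots> = (2 * a / D) powr (- 1)" using assms by (simp add: X_def powr_powr)
  also have "\<dots> = D / (2 * a)" using assms D0 by (simp add: powr_minus)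
  finally have "a * real l powr (- c) \<le> a * (D / (2 * a))" using assms by (intro mult_left_mono) auto
  then have first: "a * real l powr (- c) \<le> D / 2" using assms by simp
  \<comment> \<open>The power \<open>l ^ (2 * d)\<close> costs \<open>(2 * a / D) powr E\<close>, so
    \<open>M powr (- c')\<close> has to beat \<open>D powr (1 + E)\<close>. In
    \<open>4 ^ (d + 1)\<close>, the part \<open>4 ^ d\<close> pays for \<open>l \<le> 2 * X\<close>,
    one factor 2 for \<open>M - l \<ge> M / 2\<close>, and one for the target
    \<open>D / 2\<close>.\<close>
  define E where "E = 2 * real d / c"
  have E0: "E \<ge> 0" using assms by (simp add: E_def)
  have "real l ^ (2 * d) \<le> (2 * X) ^ (2 * d)" using l_le by (intro power_mono) auto
  also have "\<dots> = 4 ^ d * X ^ (2 * d)" by (simp add: power_mult_distrib power_mult)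
  also have "X ^ (2 * d) = X powr (2 * real d)" using X1 powr_realpow[of X "2 * d"] by simp
  also have "X powr (2 * real d) = (2 * a / D) powr E" by (simp add: X_def E_def powr_powr)
  also have "\<dots> = (2 * a) powr E / D powr E" using assms D0 by (simp add: powr_divide)
  finally have pl: "real l ^ (2 * d) \<le> 4 ^ d * ((2 * a) powr E / D powr E)" .
  have "real (M - l) powr (- c') \<le> (real M / 2) powr (- c')"
    using l_half M assms by (intro powr_mono2') auto
  also have "\<dots> = real M powr (- c') * 2 powr c'"
    using M by (simp add: powr_divide powr_minus field_simps)
  also have "\<dots> \<le> real M powr (- c') * 2 powr 1" using assms by (intro mult_left_mono powr_mono) auto
  finally have pm: "real (M - l) powr (- c') \<le> real M powr (- c') * 2" by simp
  have "(4 ^ (d + 1) * a') * (2 * a) powr E * real M powr (- c') \<le> A * A powr E * real M powr (- (C * (1 + E)))"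
    using assms M A E0 by (intro mult_mono powr_mono2 powr_mono) (auto simp: E_def)
  also have "\<dots> = A powr (1 + E) * (real M powr (- C)) powr (1 + E)"
    using A powr_powr[of "real M" "- C" "1 + E"] by (simp add: powr_add)
  also have "\<dots> = D powr (1 + E)"
    using A by (simp add: D(1) powr_mult)
  also have "\<dots> = D * D powr E" using D0 by (simp add: powr_add)
  finally have key: "(4 ^ (d + 1) * a') * (2 * a) powr E * real M powr (- c') \<le> D * D powr E" .
  have "real l ^ (2 * d) * (a' * real (M - l) powr (- c'))
      \<le> 4 ^ d * ((2 * a) powr E / D powr E) * (a' * (real M powr (- c') * 2))"
    using pl pm assms by (intro mult_mono) auto
  also have "\<dots> = ((4 ^ (d + 1) * a') * (2 * a) powr E * real M powr (- c')) / (2 * D powr E)" by simp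
  also have "\<dots> \<le> (D * D powr E) / (2 * D powr E)" using key by (intro divide_right_mono) auto
  also have "\<dots> = D / 2" using D0 by simp
  finally show ?thesis using first l1 l_half by (intro exI[of _ l]) auto
qed

subsection \<open>The bound in the cube\<close>

lemma split_by_rank:
  assumes "finite (V :: nat set)" "l \<le> card V"
  obtains L U where "V = L \<union> U" "card L = l" "card U = card V - l" "\<And>x y. x \<in> L \<Longrightarrow> y \<in> U \<Longrightarrow> x < y"
proof -
  have img: "rank V ` V = {..<card V}"
    using assms by (intro card_subset_eq) (auto simp: rank_less_card card_image inj_on_rank)
  define L where "L = {v \<in> V. rank V v < l}"
  have "rank V ` L = {..<l}"
    using img assms(2) by (auto simp: L_def set_eq_iff image_iff) (metis lessThan_iff less_le_trans imageE)
  then have cardL: "card L = l"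
    using card_image[OF inj_on_subset[OF inj_on_rank[OF assms(1)], of L]] by (auto simp: L_def)
  show thesis
  proof (rule that[of L "V - L"])
    show "card (V - L) = card V - l"
      using assms cardL by (subst card_Diff_subset) (auto simp: L_def)
    fix x y assume "x \<in> L" "y \<in> V - L"
    then have "x \<in> V" "y \<in> V" "rank V x < rank V y" by (auto simp: L_def)
    then show "x < y"
      using rank_eq_add_between[OF assms(1), of y x] by (cases x y rule: linorder_cases) auto
  qed (use cardL in \<open>auto simp: L_def\<close>)
qed

theorem cube_bound_balanced:
  assumes "balanced d P" "d \<ge> 1" "m \<ge> 1"
  shows "cube_bound P m (a_const d * real m powr (- c_const d))"
  using assms
proof (induction d arbitrary: P m rule: less_induct)
  case (less d)
  have main: "real (card \<A>) \<le> (a_const d * real (card V) powr (- c_const d)) * 2 ^ card V"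
    if V: "finite V" "V \<noteq> {}" and \<A>: "\<A> \<subseteq> Pow V" and free: "pattern_free P \<A>" for V \<A>
  proof -
    define D where "D = a_const d * real (card V) powr (- c_const d)"
    have M: "card V \<ge> 1" using V by (simp add: Suc_le_eq card_gt_0_iff)
    show ?thesis
    \<comment> \<open>For \<open>D \<ge> 1\<close> the whole cube satisfies the bound; both
      recursions rely on \<open>D < 1\<close>.\<close>
    proof (cases "D < 1")
      case False
      have "real (card \<A>) \<le> real (2 ^ card V)"
        using card_mono[OF _ \<A>] V by (simp add: card_Pow del: of_nat_power)
      also have "\<dots> \<le> D * 2 ^ card V" using False by simp
      finally show ?thesis by (simp add: D_def)
    next
      case D1: True
      \<comment> \<open>\<open>P1\<close> names the shorter pattern here, wherever it stands in
        \<open>P\<close>; it receives the \<open>l\<close> points of \<open>X\<close>.\<close>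
      have concat: "real (card \<A>) \<le> D * 2 ^ card V"
        if d: "1 \<le> e" "e \<le> f" "d = e + f" and bal: "balanced e P1" "balanced f P2"
          and split: "\<And>l. l \<le> card V \<Longrightarrow>
             \<exists>X Y. V = X \<union> Y \<and> X \<inter> Y = {} \<and> card X = l \<and> card Y = card V - l \<and> joins X Y P1 P2 P"
        for e f P1 P2
      proof -
        have pows: "(8::real) \<le> 8 ^ (5 * f)" "(4::real) ^ (e + 1) \<le> 8 ^ (5 * e)"
        proof -
          show "(8::real) \<le> 8 ^ (5 * f)" using power_increasing[of 1 "5 * f" "8::real"] d by simp
          have "(4::real) ^ (e + 1) \<le> 8 ^ (e + 1)" by (intro power_mono) auto
          also have "\<dots> \<le> 8 ^ (5 * e)" using d by (intro power_increasing) auto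
          finally show "(4::real) ^ (e + 1) \<le> 8 ^ (5 * e)" .
        qed
        have "8 * a_const e \<le> 8 ^ (5 * f) * a_const e"
          using pows a_const_ge_1[of e] by (intro mult_right_mono) auto
        also have "\<dots> \<le> a_const d" using a_const_add_ge[of f e] d by (simp add: add.commute)
        finally have a1: "8 * a_const e \<le> a_const d" .
        have "4 ^ (e + 1) * a_const f \<le> 8 ^ (5 * e) * a_const f"
          using pows a_const_ge_1[of f] by (intro mult_right_mono) auto
        also have "\<dots> \<le> a_const d" using a_const_add_ge[of e f] d by simp
        finally have a2: "4 ^ (e + 1) * a_const f \<le> a_const d" .
        have c1: "0 < c_const e" "c_const e \<le> 1" using d c_const_pos[of e] c_const_le_1[of e] by auto
        have c2: "0 \<le> c_const f" "c_const f \<le> 1" using d c_const_pos[of f] c_const_le_1[of f] by auto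
        have c: "c_const d \<le> c_const e" "0 \<le> c_const d" "c_const d * (1 + 2 * real e / c_const e) \<le> c_const f"
          using d c_const_antimono[of e d] c_const_pos[of d] c_const_add_le[of e f] by auto
        obtain l where l: "l \<ge> 1" "2 * l \<le> card V"
          and le: "a_const e * real l powr (- c_const e)
            + real l ^ (2 * e) * (a_const f * real (card V - l) powr (- c_const f)) \<le> D"
          using concat_recursion[OF a_const_ge_1 c1 a_const_ge_1 c2 a1 a2 c M D_def D1] by blast
        have "l \<le> card V" using l by simp
        from split[OF this] obtain X Y where XY: "V = X \<union> Y" "X \<inter> Y = {}" "card X = l" "card Y = card V - l"
          and joins: "joins X Y P1 P2 P"
          by blast
        have fin: "finite X" "finite Y" using V(1) unfolding XY(1) by simp_all
        have "e < d" "f < d" "f \<ge> 1" "card V - l \<ge> 1" using d l by linarith+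
        from less.IH[OF this(1) bal(1) d(1) l(1)] less.IH[OF this(2) bal(2) this(3,4)]
        have cb: "cube_bound P1 (card X) (a_const e * real l powr (- c_const e))"
          "cube_bound P2 (card Y) (a_const f * real (card V - l) powr (- c_const f))"
          unfolding XY(3,4) .
        have len: "length P1 = 2 * e" using length_pattern[of P1] bal by (simp add: balanced_def)
        have "real (card \<A>) \<le> (a_const e * real l powr (- c_const e)
            + real (card X) ^ length P1 * (a_const f * real (card V - l) powr (- c_const f))) * 2 ^ card (X \<union> Y)"
          by (rule card_free_concat_le[OF cb fin XY(2) \<A>[unfolded XY(1)] free joins])
        also have "\<dots> \<le> D * 2 ^ card V"
          unfolding XY(3) len XY(1)[symmetric] using le by (intro mult_right_mono) auto
        finally show ?thesis .
      qed
      from less.prems(1,2) have "real (card \<A>) \<le> D * 2 ^ card V"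
      proof (cases rule: balanced_split_or_enclose)
        case (1 s Q)
        show ?thesis
        \<comment> \<open>With \<open>w = 1\<close> and an empty \<open>Q\<close> of bound 0, the
          enclosed estimate gives \<open>2 / card V\<close> directly.\<close>
        proof (cases "d = 1")
          case True
          then have "length Q = 0" using 1 length_pattern[of Q] by (simp add: balanced_def)
          then have "pattern_free (s # [] @ [flip s]) \<A>" using free 1 by simp
          then have "real (card \<A>) \<le> (2 / real (card V)) * 2 ^ card V"
            using card_free_enclosed_le[OF cube_bound_Nil V(1) \<A>, of s 1] V(2) by simp
          also have "2 / real (card V) \<le> D"
          proof -
            have "2 / real (card V) = 2 * real (card V) powr (- 1)" using M by (simp add: powr_minus field_simps)
            also have "\<dots> \<le> a_const d * real (card V) powr (- c_const d)"
              using M True by (intro mult_mono powr_mono) (auto simp: a_const_def c_const_def)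
            finally show ?thesis by (simp add: D_def)
          qed
          finally show ?thesis by simp
        next
          case False
          then obtain d' where d': "d = Suc d'" "d' \<ge> 1" using less.prems(2) by (cases d) auto
          have "256 * a_const d' \<le> 8 ^ 5 * a_const d'" using a_const_ge_1[of d'] by simp
          also have "\<dots> \<le> a_const d" using a_const_add_ge[of 1 d'] d' by simp
          finally have a: "256 * a_const d' \<le> a_const d" .
          have c: "0 \<le> c_const d'" "c_const d' \<le> 1" "4 * c_const d \<le> c_const d'"
            using d' c_const_pos[of d'] c_const_le_1[of d'] c_const_Suc_le[of d'] by auto
          obtain w where w: "w \<ge> 2" and le: "2 * real w / real (card V)
              + 2 * real (card V) / real w * (a_const d' * real (w - 1) powr (- c_const d')) \<le> D"
            using enclosed_recursion[OF a_const_ge_1 c(1,2) a c(3) M D_def D1] by blast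
          have "cube_bound Q (w - 1) (a_const d' * real (w - 1) powr (- c_const d'))"
            using less.IH[of d' Q "w - 1"] 1 d' w by simp
          then have "real (card \<A>) \<le> (2 * real w / real (card V)
              + 2 * real (card V) / real w * (a_const d' * real (w - 1) powr (- c_const d'))) * 2 ^ card V"
            using V \<A> free w 1 by (intro card_free_enclosed_le) auto
          also have "\<dots> \<le> D * 2 ^ card V" using le by (intro mult_right_mono) auto
          finally show ?thesis .
        qed
      next
        case (2 P1 P2 d1 d2)
        have split: "\<exists>L U. V = L \<union> U \<and> L \<inter> U = {} \<and> card L = l \<and> card U = card V - l \<and> joins L U P1 P2 P"
          if l: "l \<le> card V" for l
        proof -
          obtain L U where LU: "V = L \<union> U" "card L = l" "card U = card V - l"
            and less: "\<And>x y. x \<in> L \<Longrightarrow> y \<in> U \<Longrightarrow> x < y"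
            using split_by_rank[OF V(1) l] by blast
          have "finite L" "finite U" using V(1) unfolding LU(1) by simp_all
          then have "joins L U P1 P2 P" unfolding 2(1) using less by (rule joins_append)
          moreover have "L \<inter> U = {}" using less by blast
          ultimately show ?thesis using LU by blast
        qed
        show ?thesis
        proof (cases "d1 \<le> d2")
          case True
          show ?thesis by (rule concat[OF 2(4) True 2(6,2,3) split])
        next
          case False
          then have "d2 \<le> d1" by simp
          moreover have "d = d2 + d1" using 2(6) by simp
          moreover have "\<exists>X Y. V = X \<union> Y \<and> X \<inter> Y = {} \<and> card X = l \<and> card Y = card V - l \<and> joins X Y P2 P1 P"
            if l: "l \<le> card V" for l
          proof -
            \<comment> \<open>The shorter pattern comes last, so the cut is at
              \<open>card V - l\<close> and the top \<open>l\<close> points are used.\<close>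
            from split[OF diff_le_self[of "card V" l]] obtain L U where LU: "V = L \<union> U" "L \<inter> U = {}"
              "card L = card V - l" "card U = card V - (card V - l)" "joins L U P1 P2 P"
              by blast
            have "joins U L P2 P1 P" using LU(5) joins_commute by blast
            moreover have "card U = l" using LU(4) l by simp
            moreover have "V = U \<union> L" "U \<inter> L = {}" using LU(1,2) by blast+
            ultimately show ?thesis using LU(3) by blast
          qed
          ultimately show ?thesis by (rule concat[OF 2(5) _ _ 2(3,2)])
        qed
      qed
      then show ?thesis by (simp add: D_def)
    qed
  qed
  show ?case
    unfolding cube_bound_def
  proof (intro allI impI)
    fix V \<A> assume V: "finite V" "m \<le> card V" and *: "\<A> \<subseteq> Pow V" "pattern_free P \<A>"
    have "real (card \<A>) \<le> (a_const d * real (card V) powr (- c_const d)) * 2 ^ card V"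
      using V * less.prems by (intro main) auto
    also have "\<dots> \<le> (a_const d * real m powr (- c_const d)) * 2 ^ card V"
      using V less.prems a_const_ge_1[of d] c_const_pos[of d]
      by (intro mult_right_mono mult_left_mono powr_mono2') auto
    finally show "real (card \<A>) \<le> (a_const d * real m powr (- c_const d)) * 2 ^ card V" .
  qed
qed

text \<open>For \<open>d \<ge> 1\<close> the power of \<open>k\<close> is infinite at
  \<open>k = 0\<close>, while \<open>powr\<close> returns 0 there; hence
  \<open>k \<ge> 1\<close>.\<close>

theorem theorem1:
  fixes d k n :: nat
  assumes "k \<ge> 1" and "2 * k \<le> n"
  shows "max_density n k d \<le> (8 * real d) ^ (5 * d) * real k powr (- (6 * real d * 8 powr (- real d)))"
proof -
  define \<beta> where "\<beta> = a_const d * real k powr (- c_const d)"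
  have \<beta>: "\<beta> = (8 * real d) ^ (5 * d) * real k powr (- (6 * real d * 8 powr (- real d)))"
    by (simp add: \<beta>_def a_const_def c_const_def powr_minus powr_realpow divide_inverse)
  have "density n k P \<le> \<beta>" if P: "balanced d P" for P
  proof -
    have bound: "real (card \<A>) \<le> \<beta> * real (n choose k)" if "\<A> \<subseteq> layer n k" "pattern_free P \<A>" for \<A>
    \<comment> \<open>The only 0-balanced pattern is empty and is realised by every pair
      \<open>(A, A)\<close>, so only the empty family is free.\<close>
    proof (cases "d = 0")
      case True
      then have "P = []" using P length_pattern[of P] by (simp add: balanced_def)
      then have "\<A> = {}" using that pat_self unfolding pattern_free_def by blast
      then show ?thesis using a_const_ge_1[of d] by (simp add: \<beta>_def)
    next
      case False
      then show ?thesis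
        using card_free_layer_le[OF cube_bound_balanced[of d P k] P _ assms(2) that] P assms
        by (simp add: \<beta>_def)
    qed
    have "max_free n k P \<in> card ` {\<A>. \<A> \<subseteq> layer n k \<and> pattern_free P \<A>}"
      unfolding max_free_def using finite_free_families free_families_nonempty by (intro Max_in) auto
    then have "real (max_free n k P) \<le> \<beta> * real (n choose k)" using bound by auto
    moreover have "real (n choose k) > 0" using assms by (simp add: zero_less_binomial)
    ultimately show ?thesis by (simp add: density_def field_simps)
  qed
  then have "max_density n k d \<le> \<beta>"
    unfolding max_density_def using finite_balanced balanced_nonempty by (subst Max_le_iff) auto
  then show ?thesis by (simp only: \<beta>)
qed

end
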